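(* Let $BF_n=f_n+f_{n+1}i+f_{n+2}j+f_{n+3}k$ and $BL_n=\ell_n+\ell_{n+1}i+\ell_{n+2}j+\ell_{n+3}k$ be the $n$th bicomplex Fibonacci and Lucas numbers in $\mathbb{BC}$, where $(f_n)_{n\ge0}$ and $(\ell_n)_{n\ge0}$ are the Fibonacci and Lucas numbers. Then the following identities hold. (1) For all $n\ge 0$: $BF_n+BL_n=2BF_{n+1}$. (2) For all $n\ge 1$: $BL_{n-1}+BL_{n+1}=5BF_n$. (3) For all $n\ge 1$: $\sum_{s=1}^{n}BL_{2s-1}=BL_{2n}-BL_0$. (4) For all $n\ge 1$: $\sum_{s=1}^{n}BL_{s}=BL_{n+2}-BL_2$. (5) For all $n\ge 1$: $\sum_{s=1}^{n}BL_{2s}=BL_{2n+1}-BL_1$. (6) For all $n\ge 0$: $5BF_n^2-BL_n^2=12(-1)^{n+1}(2j+k)$. (7) For all $n\ge 1$: $\sum_{s=1}^{n}BL_s^2=BL_nBL_{n+1}-(5-10i-12j+9k)$. (8) For all $n,m\ge 0$: $$BL_nBL_m+BL_{n+1}BL_{m+1}=5\bigl(2BF_{n+m+1}+2f_{n+m+4}-f_{n+m+1}-2f_{n+m+6}\,i-2f_{n+m+5}\,j+2f_{n+m+4}\,ij\bigr).$$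
   Context: $\mathbb{BC}=\{z_1+z_2 j : z_1,z_2\in\mathbb{C}\}$ is the algebra of bicomplex numbers: the commutative associative real algebra with basis $1,i,j,k$, where $i^2=j^2=-1$, $ij=ji=k$, $k^2=1$, $ik=ki=-j$, $jk=kj=-i$. Fibonacci numbers: $f_0=0$, $f_1=1$, $f_{n+2}=f_{n+1}+f_n$. Lucas numbers: $\ell_0=2$, $\ell_1=1$, $\ell_{n+2}=\ell_{n+1}+\ell_n$.
   Formalization: In (7) the sum of BL_s^2 starts at s=0 instead of s=1, keeping the constant 5-10i-12j+9k = BL_0 BL_1 - BL_0^2; as printed, (7) is false for every n≥1, since the sum from s=1 needs the constant BL_0 BL_1 = 15-30i-8j+31k. *)

theory Defs
  imports Complex_Main "HOL-Number_Theory.Fib"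
begin

text \<open>\<open>Bicomplex z1 z2\<close> stands for \<open>z1 + z2 j\<close>.\<close>

datatype bicomplex = Bicomplex (bc_fst: complex) (bc_snd: complex)

lemma bicomplex_eq_iff: "x = y \<longleftrightarrow> bc_fst x = bc_fst y \<and> bc_snd x = bc_snd y"
  by (cases x; cases y) simp

instantiation bicomplex :: comm_ring_1
begin

definition zero_bicomplex :: bicomplex where "0 = Bicomplex 0 0"
definition one_bicomplex :: bicomplex where "1 = Bicomplex 1 0"
definition plus_bicomplex :: "bicomplex \<Rightarrow> bicomplex \<Rightarrow> bicomplex"
  where "x + y = Bicomplex (bc_fst x + bc_fst y) (bc_snd x + bc_snd y)"
definition minus_bicomplex :: "bicomplex \<Rightarrow> bicomplex \<Rightarrow> bicomplex"
  where "x - y = Bicomplex (bc_fst x - bc_fst y) (bc_snd x - bc_snd y)"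
definition uminus_bicomplex :: "bicomplex \<Rightarrow> bicomplex"
  where "- x = Bicomplex (- bc_fst x) (- bc_snd x)"
definition times_bicomplex :: "bicomplex \<Rightarrow> bicomplex \<Rightarrow> bicomplex"
  where "x * y = Bicomplex (bc_fst x * bc_fst y - bc_snd x * bc_snd y)
                           (bc_fst x * bc_snd y + bc_snd x * bc_fst y)"

instance
  by standard
    (simp_all add: bicomplex_eq_iff zero_bicomplex_def one_bicomplex_def plus_bicomplex_def
      minus_bicomplex_def uminus_bicomplex_def times_bicomplex_def algebra_simps)

end

instantiation bicomplex :: real_algebra_1
begin

definition scaleR_bicomplex :: "real \<Rightarrow> bicomplex \<Rightarrow> bicomplex"
  where "r *\<^sub>R x = Bicomplex (r *\<^sub>R bc_fst x) (r *\<^sub>R bc_snd x)"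

instance
  by standard
    (simp_all add: bicomplex_eq_iff scaleR_bicomplex_def plus_bicomplex_def times_bicomplex_def
      algebra_simps)

end

definition bc_i :: bicomplex where "bc_i = Bicomplex \<i> 0"
definition bc_j :: bicomplex where "bc_j = Bicomplex 0 1"
definition bc_k :: bicomplex where "bc_k = bc_i * bc_j"

lemmas bicomplex_defs =
  zero_bicomplex_def one_bicomplex_def plus_bicomplex_def minus_bicomplex_def
  uminus_bicomplex_def times_bicomplex_def scaleR_bicomplex_def bc_i_def bc_j_def bc_k_def

lemma bicomplex_unit_mult:
  "bc_i * bc_i = -1" "bc_j * bc_j = -1" "bc_k * bc_k = 1"
  "bc_i * bc_j = bc_k" "bc_j * bc_i = bc_k"
  "bc_i * bc_k = - bc_j" "bc_k * bc_i = - bc_j"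
  "bc_j * bc_k = - bc_i" "bc_k * bc_j = - bc_i"
  by (simp_all add: bicomplex_defs)

lemma bicomplex_basis:
  "\<exists>!(a, b, c, d). x = a *\<^sub>R 1 + b *\<^sub>R bc_i + c *\<^sub>R bc_j + d *\<^sub>R bc_k"
proof -
  have "x = a *\<^sub>R 1 + b *\<^sub>R bc_i + c *\<^sub>R bc_j + d *\<^sub>R bc_k \<longleftrightarrow>
      a = Re (bc_fst x) \<and> b = Im (bc_fst x) \<and> c = Re (bc_snd x) \<and> d = Im (bc_snd x)"
    for a b c d
    by (auto simp: bicomplex_eq_iff bicomplex_defs complex_eq_iff)
  then show ?thesis by auto
qed

fun lucas :: "nat \<Rightarrow> nat" where
  "lucas 0 = 2"
| "lucas (Suc 0) = 1"
| "lucas (Suc (Suc n)) = lucas (Suc n) + lucas n"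

definition BF :: "nat \<Rightarrow> bicomplex" where
  "BF n = of_nat (fib n) + of_nat (fib (n + 1)) * bc_i
        + of_nat (fib (n + 2)) * bc_j + of_nat (fib (n + 3)) * bc_k"

definition BL :: "nat \<Rightarrow> bicomplex" where
  "BL n = of_nat (lucas n) + of_nat (lucas (n + 1)) * bc_i
        + of_nat (lucas (n + 2)) * bc_j + of_nat (lucas (n + 3)) * bc_k"

text \<open>The source states the sum of the squares \<open>BL s ^ 2\<close> with lower limit \<open>s = 1\<close> and the constant
  \<open>5 - 10i - 12j + 9k\<close>. That combination is false, already for \<open>n = 1\<close>, as shown below. The
  constant equals \<open>BL 0 * BL 1 - (BL 0)^2\<close>, which is the one for the sum starting at \<open>s = 0\<close>;
  the sum starting at \<open>s = 1\<close> has the constant \<open>BL 0 * BL 1 = 15 - 30i - 8j + 31k\<close>.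
  The theorem therefore uses the lower limit \<open>0\<close>, keeping the constant.\<close>

lemma sum_squares_BL_from_1_fails:
  "(\<Sum>s=1..1. BL s ^ 2) \<noteq> BL 1 * BL 2 - (5 - 10 * bc_i - 12 * bc_j + 9 * bc_k)"
proof -
  have num: "(numeral w :: bicomplex) = Bicomplex (numeral w) 0" for w
    by (induction w)
      (simp_all only: numeral.simps bicomplex_defs bicomplex.sel, simp_all)
  have "BL 1 = Bicomplex (Complex 1 3) (Complex 4 7)"
    by (simp add: BL_def num bicomplex_defs eval_nat_numeral complex_eq_iff)
  moreover have "BL 2 = Bicomplex (Complex 3 4) (Complex 7 11)"
    by (simp add: BL_def num bicomplex_defs eval_nat_numeral complex_eq_iff)
  ultimately show ?thesis
    by (simp add: num power2_eq_square bicomplex_defs complex_eq_iff)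
qed

end

theory Submission
  imports Defs
begin

text \<open>Both sequences satisfy the Fibonacci recurrence and \<open>BL n = 2 * BF (n + 1) - BF n\<close>, which
  makes the linear identities and the telescoping sums immediate. For the quadratic ones,
  \<open>5 * (BF n)^2 - (BL n)^2\<close> is four times the Cassini form
  \<open>(BF n)^2 + BF n * BF (n + 1) - (BF (n + 1))^2\<close>, which
  changes sign when \<open>n\<close> increases by one; and
  \<open>BL n * BL m + BL (n + 1) * BL (m + 1) = 5 * (BF n * BF m + BF (n + 1) * BF (m + 1))\<close>, where
  expanding \<open>BF n\<close> in the basis reduces to the addition formula
  \<open>fib n * BF m + fib (n + 1) * BF (m + 1) = BF (n + m + 1)\<close>.\<close>

text \<open>Since \<open>algebra_simps\<close> nests products to the right, two adjacent units may
  carry a further factor \<open>x\<close>; these forms let the unit table apply there too.\<close>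

lemma bicomplex_unit_mult_left:
  "bc_i * (bc_i * x) = - x" "bc_j * (bc_j * x) = - x" "bc_k * (bc_k * x) = x"
  "bc_i * (bc_j * x) = bc_k * x" "bc_j * (bc_i * x) = bc_k * x"
  "bc_i * (bc_k * x) = - (bc_j * x)" "bc_k * (bc_i * x) = - (bc_j * x)"
  "bc_j * (bc_k * x) = - (bc_i * x)" "bc_k * (bc_j * x) = - (bc_i * x)"
  by (simp_all add: bicomplex_unit_mult flip: mult.assoc)

lemmas bicomplex_expand = bicomplex_unit_mult bicomplex_unit_mult_left algebra_simps

lemma BF_rec: "BF (Suc (Suc n)) = BF (Suc n) + BF n"
  by (simp add: BF_def eval_nat_numeral algebra_simps)

lemma BL_rec: "BL (Suc (Suc n)) = BL (Suc n) + BL n"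
  by (simp add: BL_def eval_nat_numeral algebra_simps)

lemma BL_BF: "BL n = 2 * BF (Suc n) - BF n"
proof (induction n rule: lucas.induct)
  case (3 n)
  then show ?case
    by (simp add: BL_rec BF_rec)
qed (simp_all add: BL_def BF_def eval_nat_numeral algebra_simps)

text \<open>Expresses \<open>BL (Suc n)\<close> in the same pair \<open>BF n\<close>,
  \<open>BF (Suc n)\<close> as \<open>BL_BF\<close> does for \<open>BL n\<close>.\<close>

lemma BL_Suc_BF: "BL (Suc n) = 2 * BF n + BF (Suc n)"
  by (simp add: BL_BF BF_rec)

lemma BF_cassini:
  "BF n ^ 2 + BF n * BF (Suc n) - BF (Suc n) ^ 2 = (-1) ^ (n + 1) * (3 * (2 * bc_j + bc_k))"
proof (induction n)
  case 0
  have "BF 0 = bc_i + bc_j + 2 * bc_k" "BF (Suc 0) = 1 + bc_i + 2 * bc_j + 3 * bc_k"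
    by (simp_all add: BF_def eval_nat_numeral algebra_simps)
  then show ?case
    by (simp add: power2_eq_square bicomplex_expand)
next
  case (Suc n)
  have "BF (Suc n) ^ 2 + BF (Suc n) * BF (Suc (Suc n)) - BF (Suc (Suc n)) ^ 2
      = - (BF n ^ 2 + BF n * BF (Suc n) - BF (Suc n) ^ 2)"
    by (simp add: BF_rec power2_eq_square algebra_simps)
  with Suc show ?case
    by simp
qed

lemma BF_add: "of_nat (fib n) * BF m + of_nat (fib (Suc n)) * BF (Suc m) = BF (Suc (n + m))"
proof (induction n arbitrary: m)
  case (Suc n)
  \<comment> \<open>Expanding \<open>fib (n + 2)\<close> moves one index step from \<open>n\<close>
    to \<open>m\<close>, hence the hypothesis at \<open>Suc m\<close>.\<close>
  from Suc[of "Suc m"] show ?case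
    by (simp add: BF_rec algebra_simps)
qed simp

lemma BF_mult_add:
  "BF n * BF m + BF (Suc n) * BF (Suc m)
    = BF (n + m + 1) + bc_i * BF (n + m + 2) + bc_j * BF (n + m + 3) + bc_k * BF (n + m + 4)"
proof -
  \<comment> \<open>\<open>?s a\<close> collects the factor of the unit number \<open>a\<close> in
    the list 1, i, j, k; \<open>BF_add\<close> evaluates it to
    \<open>BF (Suc (n + a + m))\<close>.\<close>
  let ?s = "\<lambda>a. of_nat (fib (n + a)) * BF m + of_nat (fib (Suc (n + a))) * BF (Suc m)"
  have "BF n * BF m + BF (Suc n) * BF (Suc m) = ?s 0 + bc_i * ?s 1 + bc_j * ?s 2 + bc_k * ?s 3"
    unfolding BF_def[of n] BF_def[of "Suc n"] by (simp add: algebra_simps del: fib.simps)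
  then show ?thesis
    unfolding BF_add by (simp add: eval_nat_numeral ac_simps)
qed

lemma BF_combination:
  "BF (p + 1) + bc_i * BF (p + 2) + bc_j * BF (p + 3) + bc_k * BF (p + 4)
    = 2 * BF (p + 1) + 2 * of_nat (fib (p + 4)) - of_nat (fib (p + 1))
      - 2 * of_nat (fib (p + 6)) * bc_i - 2 * of_nat (fib (p + 5)) * bc_j
      + 2 * of_nat (fib (p + 4)) * (bc_i * bc_j)"
proof -
  \<comment> \<open>All Fibonacci numbers involved are linear in these two, so the claim becomes a
    polynomial identity in \<open>x\<close>, \<open>y\<close> and the units.\<close>
  define x y :: bicomplex where "x = of_nat (fib (p + 1))" and "y = of_nat (fib (p + 2))"
  have "of_nat (fib (p + 4)) = x + 2 * y" "of_nat (fib (p + 5)) = 2 * x + 3 * y"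
    "of_nat (fib (p + 6)) = 3 * x + 5 * y"
    by (simp_all add: x_def y_def eval_nat_numeral algebra_simps)
  note fib_xy = this x_def[symmetric]
  have "BF (p + 1) = x + y * bc_i + (x + y) * bc_j + (x + 2 * y) * bc_k"
    "BF (p + 2) = y + (x + y) * bc_i + (x + 2 * y) * bc_j + (2 * x + 3 * y) * bc_k"
    "BF (p + 3) = (x + y) + (x + 2 * y) * bc_i + (2 * x + 3 * y) * bc_j + (3 * x + 5 * y) * bc_k"
    "BF (p + 4) = (x + 2 * y) + (2 * x + 3 * y) * bc_i + (3 * x + 5 * y) * bc_j + (5 * x + 8 * y) * bc_k"
    by (simp_all add: BF_def x_def y_def eval_nat_numeral algebra_simps)
  then show ?thesis
    by (simp only: fib_xy) (simp add: bicomplex_expand)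
qed

lemma sum_BL_odd: "(\<Sum>s=1..n. BL (2 * s - 1)) = BL (2 * n) - BL 0"
  by (induction n) (simp_all add: BL_rec)

lemma sum_BL: "(\<Sum>s=1..n. BL s) = BL (n + 2) - BL 2"
  by (induction n) (simp_all add: BL_rec eval_nat_numeral)

lemma sum_BL_even: "(\<Sum>s=1..n. BL (2 * s)) = BL (2 * n + 1) - BL 1"
  by (induction n) (simp_all add: BL_rec)

text \<open>For s > 0 the square of \<open>BL s\<close> is
  \<open>BL s * BL (s + 1) - BL (s - 1) * BL s\<close>, so the sum telescopes.\<close>

lemma sum_BL_squares:
  "(\<Sum>s=0..n. (BL s)\<^sup>2) = BL n * BL (Suc n) - (5 - 10 * bc_i - 12 * bc_j + 9 * bc_k)"
proof (induction n)
  case 0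
  have "BL 0 = 2 + bc_i + 3 * bc_j + 4 * bc_k" "BL (Suc 0) = 1 + 3 * bc_i + 4 * bc_j + 7 * bc_k"
    by (simp_all add: BL_def eval_nat_numeral algebra_simps)
  then show ?case
    by (simp add: power2_eq_square bicomplex_expand)
next
  case (Suc n)
  then show ?case
    by (simp add: BL_rec power2_eq_square algebra_simps)
qed

text \<open>The map (a, b) to (2b - a, 2a + b) has a symmetric matrix with square 5 times the
  identity, so it scales the form ac + bd by 5.\<close>

lemma BL_mult_add:
  "BL n * BL m + BL (Suc n) * BL (Suc m) = 5 * (BF n * BF m + BF (Suc n) * BF (Suc m))"
  by (simp add: BL_Suc_BF) (simp add: BL_BF algebra_simps)

theorem theorem2p3:
  shows
    "(\<forall>n. BF n + BL n = 2 * BF (n + 1)) \<and>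
     (\<forall>n\<ge>1. BL (n - 1) + BL (n + 1) = 5 * BF n) \<and>
     (\<forall>n\<ge>1. (\<Sum>s=1..n. BL (2 * s - 1)) = BL (2 * n) - BL 0) \<and>
     (\<forall>n\<ge>1. (\<Sum>s=1..n. BL s) = BL (n + 2) - BL 2) \<and>
     (\<forall>n\<ge>1. (\<Sum>s=1..n. BL (2 * s)) = BL (2 * n + 1) - BL 1) \<and>
     (\<forall>n. 5 * (BF n)^2 - (BL n)^2 = 12 * (-1)^(n + 1) * (2 * bc_j + bc_k)) \<and>
     (\<forall>n\<ge>1. (\<Sum>s=0..n. (BL s)^2)
        = BL n * BL (n + 1) - (5 - 10 * bc_i - 12 * bc_j + 9 * bc_k)) \<and>
     (\<forall>n m. BL n * BL m + BL (n + 1) * BL (m + 1)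
        = 5 * (2 * BF (n + m + 1) + 2 * of_nat (fib (n + m + 4)) - of_nat (fib (n + m + 1))
               - 2 * of_nat (fib (n + m + 6)) * bc_i - 2 * of_nat (fib (n + m + 5)) * bc_j
               + 2 * of_nat (fib (n + m + 4)) * (bc_i * bc_j)))"
proof (intro conjI allI impI)
  fix n m :: nat
  show "BF n + BL n = 2 * BF (n + 1)"
    by (simp add: BL_BF)
  show "5 * (BF n)\<^sup>2 - (BL n)\<^sup>2 = 12 * (-1) ^ (n + 1) * (2 * bc_j + bc_k)"
  proof -
    have "5 * (BF n)\<^sup>2 - (BL n)\<^sup>2 = 4 * (BF n ^ 2 + BF n * BF (Suc n) - BF (Suc n) ^ 2)"
      by (simp add: BL_BF power2_eq_square algebra_simps)
    then show ?thesis
      by (simp only: BF_cassini) (simp add: algebra_simps)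
  qed
  show "BL n * BL m + BL (n + 1) * BL (m + 1)
      = 5 * (2 * BF (n + m + 1) + 2 * of_nat (fib (n + m + 4)) - of_nat (fib (n + m + 1))
             - 2 * of_nat (fib (n + m + 6)) * bc_i - 2 * of_nat (fib (n + m + 5)) * bc_j
             + 2 * of_nat (fib (n + m + 4)) * (bc_i * bc_j))"
    using BL_mult_add[of n m] unfolding BF_mult_add BF_combination by simp
next
  fix n :: nat
  assume "n \<ge> 1"
  \<comment> \<open>Writing \<open>n\<close> as a successor removes the truncated subtraction in
    \<open>BL (n - 1)\<close>.\<close>
  then obtain k where n: "n = Suc k"
    by (cases n) auto
  show "BL (n - 1) + BL (n + 1) = 5 * BF n"
    by (simp add: n BL_BF BF_rec algebra_simps)
qed (use sum_BL_odd sum_BL sum_BL_even sum_BL_squares in simp_all)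

end
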